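(* Let $n\ge 1$, and let $m\ge0$ and $2\le k\le n+1$ be integers. The arrangement of affine hyperplanes in $\mathbb{R}^n$ consisting of the hyperplanes $x_1-x_j=0,1,\ldots,m$ for $2\le j<k$, the hyperplanes $x_1-x_j=0,1,\ldots,m+1$ for $k\le j\le n$, and the hyperplanes $x_i-x_j=0$ and $x_i-x_j=1$ for $2\le i<j\le n$, has exactly $(n+m)^{k-2}(n+m+1)^{n-k+1}$ regions. In particular (taking $m=0$, $k=2$), the Shi arrangement in $\mathbb{R}^n$, consisting of the hyperplanes $x_i-x_j=0$ and $x_i-x_j=1$ for $1\le i<j\le n$, has $(n+1)^{n-1}$ regions.
   Context: A region of a finite arrangement of affine hyperplanes in $\mathbb{R}^n$ is a connected component of the complement of the union of its hyperplanes. *)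

theory Defs
  imports "HOL-Analysis.Analysis"
begin

text \<open>R^n is modelled as the points x :: nat \<Rightarrow> real with x i = 0 for i outside {1..n}
  (coordinates x_1..x_n), with the (product) topology of nat \<Rightarrow> real, which on this
  subspace is the Euclidean topology.\<close>

definition Rn :: "nat \<Rightarrow> (nat \<Rightarrow> real) set" where
  "Rn n = {x. \<forall>i. i \<notin> {1..n} \<longrightarrow> x i = 0}"

definition hyp :: "nat \<Rightarrow> nat \<Rightarrow> nat \<Rightarrow> real \<Rightarrow> (nat \<Rightarrow> real) set" where
  "hyp n i j c = {x \<in> Rn n. x i - x j = c}"

definition regions :: "nat \<Rightarrow> (nat \<Rightarrow> real) set set \<Rightarrow> (nat \<Rightarrow> real) set set" where
  "regions n A = {connected_component_set (Rn n - \<Union>A) x | x. x \<in> Rn n - \<Union>A}"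

definition arr :: "nat \<Rightarrow> nat \<Rightarrow> nat \<Rightarrow> (nat \<Rightarrow> real) set set" where
  "arr n m k =
     {hyp n 1 j (real c) | j c. 2 \<le> j \<and> j < k \<and> c \<le> m}
   \<union> {hyp n 1 j (real c) | j c. k \<le> j \<and> j \<le> n \<and> c \<le> m + 1}
   \<union> {hyp n i j c | i j c. 2 \<le> i \<and> i < j \<and> j \<le> n \<and> (c = 0 \<or> c = 1)}"

definition shi :: "nat \<Rightarrow> (nat \<Rightarrow> real) set set" where
  "shi n = {hyp n i j c | i j c. 1 \<le> i \<and> i < j \<and> j \<le> n \<and> (c = 0 \<or> c = 1)}"

end

theory Submission
  imports Defs
begin

text \<open>Regions are counted by deletion and restriction. Deleting the hyperplane $x_1 - x_k = m+1$
  from the arrangement with parameters $(n,m,k)$ leaves the one with parameters $(n,m,k+1)$;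
  restricting to it, i.e. substituting $x_k = x_1 - m - 1$, turns the hyperplanes $x_i - x_k = 0, 1$
  and $x_k - x_j = 0, 1$ into $x_1 - x_i = m+1, m$ and $x_1 - x_j = m+1, m+2$, which gives the
  arrangement with parameters $(n-1,m+1,k)$. Since $(n,m,2)$ and $(n,m+1,n+1)$ describe the same
  arrangement, this reduces everything to $(n,0,n+1)$. There $x_1$ is only compared with
  $x_2,\ldots,x_n$ by order, so each region of the Shi arrangement in $x_2,\ldots,x_n$
  is cut into $n$ pieces.\<close>

section \<open>Sign vectors of arrangements\<close>

text \<open>The triple $(i,j,c)$ stands for the hyperplane $x_i - x_j = c$.\<close>

type_synonym form = "nat \<times> nat \<times> real"

definition form_val :: "form \<Rightarrow> (nat \<Rightarrow> real) \<Rightarrow> real" where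
  "form_val e x = (case e of (i, j, c) \<Rightarrow> x i - x j - c)"

lemma form_val_simp: "form_val (i, j, c) x = x i - x j - c"
  by (simp add: form_val_def)

definition generic :: "form set \<Rightarrow> (nat \<Rightarrow> real) set" where
  "generic C = {x. \<forall>e\<in>C. form_val e x \<noteq> 0}"

text \<open>The default 0 off \<open>C\<close> makes equality of sign vectors the same as agreement
  on \<open>C\<close>, and leaves only finitely many candidates when \<open>C\<close> is
  finite.\<close>

definition signs :: "form set \<Rightarrow> (nat \<Rightarrow> real) \<Rightarrow> form \<Rightarrow> real" where
  "signs C x = (\<lambda>e. if e \<in> C then sgn (form_val e x) else 0)"

text \<open>Points range over all of \<open>nat \<Rightarrow> real\<close> rather than
  \<open>Rn n\<close>. Coordinates that no form mentions do not affect signs, so re-indexing maps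
  need not preserve a support condition.\<close>

definition num_cells :: "form set \<Rightarrow> nat" where
  "num_cells C = card (signs C ` generic C)"

lemma signs_eq_iff: "signs C x = signs C y \<longleftrightarrow> (\<forall>e\<in>C. sgn (form_val e x) = sgn (form_val e y))"
  by (auto simp: signs_def fun_eq_iff)

lemma finite_signs_image:
  assumes "finite C"
  shows "finite (signs C ` X)"
proof (rule finite_subset)
  show "signs C ` X \<subseteq> {f. (\<forall>e\<in>C. f e \<in> {-1, 0, 1}) \<and> (\<forall>e. e \<notin> C \<longrightarrow> f e = 0)}"
    by (intro image_subsetI) (simp add: signs_def sgn_if del: split_paired_All)
  show "finite {f. (\<forall>e\<in>C. f e \<in> {-1, 0, 1 :: real}) \<and> (\<forall>e. e \<notin> C \<longrightarrow> f e = 0)}"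
  proof -
    have "{f. (\<forall>e\<in>C. f e \<in> {-1, 0, 1 :: real}) \<and> (\<forall>e. e \<notin> C \<longrightarrow> f e = 0)}
        = {f. \<forall>e. (e \<in> C \<longrightarrow> f e \<in> {-1, 0, 1}) \<and> (e \<notin> C \<longrightarrow> f e = 0)}"
      by blast
    also have "finite \<dots>"
      by (rule finite_set_of_finite_funs) (use assms in auto)
    finally show ?thesis .
  qed
qed

text \<open>The map \<open>f\<close> may be neither injective nor surjective; it descends to a
  bijection from the fibres of \<open>g\<close> on \<open>X\<close> to those of \<open>h\<close> on
  \<open>Y\<close>.\<close>

lemma card_image_eq_transfer:
  assumes "\<And>x. x \<in> X \<Longrightarrow> f x \<in> Y"
    and "\<And>y. y \<in> Y \<Longrightarrow> \<exists>x\<in>X. h (f x) = h y"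
    and "\<And>x x'. x \<in> X \<Longrightarrow> x' \<in> X \<Longrightarrow> g x = g x' \<longleftrightarrow> h (f x) = h (f x')"
  shows "card (g ` X) = card (h ` Y)"
proof -
  let ?r = "inv_into X g"
  have r: "?r (g x) \<in> X" "g (?r (g x)) = g x" if "x \<in> X" for x
    using that by (auto intro: inv_into_into f_inv_into_f)
  have "inj_on (\<lambda>u. h (f (?r u))) (g ` X)"
    by (rule inj_onI) (metis (no_types, lifting) assms(3) imageE r)
  moreover have "(\<lambda>u. h (f (?r u))) ` (g ` X) = h ` Y"
  proof (intro equalityI subsetI)
    fix v assume "v \<in> (\<lambda>u. h (f (?r u))) ` (g ` X)"
    then show "v \<in> h ` Y" using assms(1) r(1) by blast
  next
    fix v assume "v \<in> h ` Y"
    then obtain y where "y \<in> Y" "v = h y" by blast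
    then obtain x where x: "x \<in> X" "h (f x) = v" using assms(2) by metis
    then have "h (f (?r (g x))) = v" using assms(3) r by metis
    then show "v \<in> (\<lambda>u. h (f (?r u))) ` (g ` X)" using x(1) by blast
  qed
  ultimately show ?thesis by (metis card_image)
qed

lemma sgn_lincomb:
  fixes u v s t :: real
  assumes "sgn u = sgn v" "u \<noteq> 0" "0 \<le> s" "0 \<le> t" "s + t = 1"
  shows "sgn (s * u + t * v) = sgn u"
proof (cases "u > 0")
  case True
  then have "v > 0" using assms(1) by (simp add: sgn_if split: if_splits)
  have "s * u + t * v > 0"
  proof (cases "s = 0")
    case True
    then show ?thesis using assms \<open>v > 0\<close> by simp
  next
    case False
    then have "s * u > 0" "t * v \<ge> 0" using assms \<open>u > 0\<close> \<open>v > 0\<close> by auto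
    then show ?thesis by linarith
  qed
  then show ?thesis using True by simp
next
  case False
  then have "u < 0" "v < 0" using assms(1,2) by (auto simp: sgn_if split: if_splits)
  have "s * u + t * v < 0"
  proof (cases "s = 0")
    case True
    then show ?thesis using assms \<open>v < 0\<close> by simp
  next
    case False
    then have "s * u < 0" "t * v \<le> 0" using assms \<open>u < 0\<close> \<open>v < 0\<close>
      by (auto simp: mult_less_0_iff mult_le_0_iff)
    then show ?thesis by linarith
  qed
  then show ?thesis using \<open>u < 0\<close> by simp
qed

lemma form_val_lincomb:
  assumes "s + t = 1"
  shows "form_val e (\<lambda>i. s * x i + t * y i) = s * form_val e x + t * form_val e y"
proof -
  obtain i j c where e: "e = (i, j, c)" by (cases e)
  have "c = s * c + t * c" using assms by (metis distrib_right mult_1)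
  then show ?thesis unfolding e by (simp add: form_val_simp algebra_simps)
qed

text \<open>Sign classes are convex: forms are affine, and two nonzero values of equal sign average
  to a value of that sign.\<close>

lemma signs_lincomb:
  assumes "x \<in> generic C" "signs C x = signs C y" "0 \<le> s" "0 \<le> t" "s + t = 1"
  shows "signs C (\<lambda>i. s * x i + t * y i) = signs C x"
  unfolding signs_eq_iff form_val_lincomb[OF assms(5)]
  using assms by (intro ballI sgn_lincomb) (simp_all add: signs_eq_iff generic_def)

lemma generic_cong_signs:
  assumes "x \<in> generic C" "signs C y = signs C x"
  shows "y \<in> generic C"
  using assms unfolding signs_eq_iff generic_def mem_Collect_eq by (metis sgn_zero_iff)

text \<open>Finitely many nonzero form values have a positive least modulus, and moving one
  coordinate by \<open>t\<close> changes each value by at most \<open>\<bar>t\<bar>\<close>.\<close>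

lemma signs_perturb:
  assumes "finite C" "x \<in> generic C"
  obtains \<epsilon> where "\<epsilon> > 0"
    "\<And>t. \<bar>t\<bar> < \<epsilon> \<Longrightarrow> signs C (x(a := x a + t)) = signs C x"
proof
  \<comment> \<open>The extra element 1 keeps the minimum meaningful when \<open>C\<close> is
    empty.\<close>
  define \<epsilon> where "\<epsilon> = Min (insert 1 ((\<lambda>e. \<bar>form_val e x\<bar>) ` C))"
  show "\<epsilon> > 0" using assms by (auto simp: \<epsilon>_def generic_def)
  fix t :: real assume t: "\<bar>t\<bar> < \<epsilon>"
  have "sgn (form_val e (x(a := x a + t))) = sgn (form_val e x)" if "e \<in> C" for e
  proof -
    obtain i j c where e: "e = (i, j, c)" by (cases e)
    have "\<epsilon> \<le> \<bar>form_val e x\<bar>" unfolding \<epsilon>_def using that assms(1) by (intro Min_le) auto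
    moreover have "\<bar>form_val e (x(a := x a + t)) - form_val e x\<bar> \<le> \<bar>t\<bar>" by (simp add: e form_val_simp)
    ultimately show ?thesis using t by (auto simp: sgn_if)
  qed
  then show "signs C (x(a := x a + t)) = signs C x" by (simp add: signs_eq_iff)
qed

section \<open>Deletion and restriction\<close>

text \<open>The new hyperplane cuts exactly those cells of \<open>C\<close> that it meets, each into
  two. Formally, the cells meeting the open sides \<open>?P\<close> and \<open>?M\<close> are
  counted by inclusion-exclusion: their union is all cells, their intersection the cells meeting
  \<open>?Z\<close>.\<close>

lemma num_cells_insert:
  assumes C: "finite C" and "a \<noteq> b"
  shows "num_cells (insert (a, b, d) C)
       = num_cells C + card (signs C ` {x \<in> generic C. x a - x b = d})"
proof (cases "(a, b, d) \<in> C")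
  case True
  then have "{x \<in> generic C. x a - x b = d} = {}" by (force simp: generic_def form_val_simp)
  then show ?thesis using True by (simp only: insert_absorb image_empty card.empty add_0_right)
next
  case False
  let ?h = "(a, b, d)" and ?D = "insert (a, b, d) C"
  let ?P = "{x \<in> generic C. x a - x b > d}"
  let ?M = "{x \<in> generic C. x a - x b < d}"
  let ?Z = "{x \<in> generic C. x a - x b = d}"
  have gen: "generic ?D = ?P \<union> ?M" unfolding generic_def by (auto simp: form_val_simp)
  have eqD: "signs ?D x = signs ?D y \<longleftrightarrow> signs C x = signs C y"
    if "x \<in> ?P \<and> y \<in> ?P \<or> x \<in> ?M \<and> y \<in> ?M" for x y
    using that unfolding signs_eq_iff by (auto simp: form_val_simp)
  have "card (signs ?D ` ?P) = card (signs C ` ?P)"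
    by (rule card_image_eq_transfer[where f = "\<lambda>x. x"]) (use eqD in blast)+
  moreover have "card (signs ?D ` ?M) = card (signs C ` ?M)"
    by (rule card_image_eq_transfer[where f = "\<lambda>x. x"]) (use eqD in blast)+
  moreover have "signs ?D ` ?P \<inter> signs ?D ` ?M = {}"
    by (auto simp: signs_eq_iff form_val_simp)
  ultimately have 1: "num_cells ?D = card (signs C ` ?P) + card (signs C ` ?M)"
    unfolding num_cells_def gen image_Un
    by (subst card_Un_disjoint) (use C in \<open>auto intro!: finite_signs_image\<close>)
  \<comment> \<open>A cell meeting the hyperplane reaches both sides: as
    \<open>a \<noteq> b\<close>, a small shift of coordinate \<open>a\<close> leaves the hyperplane
    but not the cell.\<close>
  have push: "\<exists>y\<in>?P. signs C y = signs C x" "\<exists>y\<in>?M. signs C y = signs C x"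
    if x: "x \<in> ?Z" for x
  proof -
    obtain \<epsilon> where \<epsilon>: "\<epsilon> > 0" "\<And>t. \<bar>t\<bar> < \<epsilon> \<Longrightarrow> signs C (x(a := x a + t)) = signs C x"
      using signs_perturb[OF C, of x a] x by blast
    have *: "signs C (x(a := x a + t)) = signs C x" "x(a := x a + t) \<in> generic C"
      if "\<bar>t\<bar> < \<epsilon>" for t
      using \<epsilon>(2)[OF that] generic_cong_signs x by blast+
    show "\<exists>y\<in>?P. signs C y = signs C x"
      using *[of "\<epsilon> / 2"] \<epsilon>(1) x \<open>a \<noteq> b\<close> by (intro bexI[of _ "x(a := x a + \<epsilon> / 2)"]) auto
    show "\<exists>y\<in>?M. signs C y = signs C x"
      using *[of "- \<epsilon> / 2"] \<epsilon>(1) x \<open>a \<noteq> b\<close> by (intro bexI[of _ "x(a := x a + - \<epsilon> / 2)"]) auto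
  qed
  have "signs C ` ?P \<union> signs C ` ?M = signs C ` generic C"
  proof
    show "signs C ` generic C \<subseteq> signs C ` ?P \<union> signs C ` ?M"
    proof clarify
      fix x assume x: "x \<in> generic C" and nM: "signs C x \<notin> signs C ` ?M"
      consider "x \<in> ?P" | "x \<in> ?M" | "x \<in> ?Z" using x by fastforce
      then show "signs C x \<in> signs C ` ?P"
        by cases (use nM push in \<open>auto simp: image_iff\<close>, metis)
    qed
  qed auto
  moreover have "signs C ` ?P \<inter> signs C ` ?M = signs C ` ?Z"
  proof
    show "signs C ` ?Z \<subseteq> signs C ` ?P \<inter> signs C ` ?M"
    proof
      fix v assume "v \<in> signs C ` ?Z"
      then obtain x where x: "x \<in> ?Z" "v = signs C x" by blast
      obtain y where y: "y \<in> ?P" "signs C y = signs C x" using push(1)[OF x(1)] by blast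
      obtain z where z: "z \<in> ?M" "signs C z = signs C x" using push(2)[OF x(1)] by blast
      have "v \<in> signs C ` ?P" by (rule image_eqI[OF _ y(1)]) (simp add: x y)
      moreover have "v \<in> signs C ` ?M" by (rule image_eqI[OF _ z(1)]) (simp add: x z)
      ultimately show "v \<in> signs C ` ?P \<inter> signs C ` ?M" by blast
    qed
    show "signs C ` ?P \<inter> signs C ` ?M \<subseteq> signs C ` ?Z"
    proof
      fix v assume "v \<in> signs C ` ?P \<inter> signs C ` ?M"
      then obtain x y where x: "x \<in> ?P" "v = signs C x" and y: "y \<in> ?M" "v = signs C y"
        by blast
      \<comment> \<open>The new form takes the values \<open>p > 0\<close> at \<open>x\<close> and
        \<open>- q < 0\<close> at \<open>y\<close>; the weights below pick the point of the segment
        where it vanishes, which convexity keeps in the cell.\<close>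
      define p q where pq: "p = form_val ?h x" "q = - form_val ?h y"
      let ?s = "q / (p + q)" and ?t = "p / (p + q)"
      let ?z = "\<lambda>i. ?s * x i + ?t * y i"
      have pos: "p > 0" "q > 0" using x(1) y(1) by (auto simp: pq form_val_simp)
      then have st: "?s \<ge> 0" "?t \<ge> 0" "?s + ?t = 1"
        by (auto simp: add_divide_distrib[symmetric] add.commute)
      have z: "signs C ?z = signs C x"
        using signs_lincomb[of x C y ?s ?t] x y st by auto
      have "form_val ?h ?z = ?s * p + ?t * - q"
        unfolding pq minus_minus by (rule form_val_lincomb) (use st(3) pq in simp)
      also have "\<dots> = 0" by simp
      finally have "?z a - ?z b = d" unfolding form_val_simp by linarith
      then have "?z \<in> ?Z" using generic_cong_signs[OF _ z] x by blast
      moreover have "v = signs C ?z" using z x(2) by simp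
      ultimately show "v \<in> signs C ` ?Z" by blast
    qed
  qed
  ultimately have "card (signs C ` ?P) + card (signs C ` ?M) = num_cells C + card (signs C ` ?Z)"
    unfolding num_cells_def by (subst card_Un_Int) (use C in \<open>auto intro!: finite_signs_image\<close>)
  then show ?thesis using 1 by simp
qed

text \<open>Here \<open>f\<close> reads off new coordinates on \<open>H\<close> and \<open>g\<close>
  is a section of it. On \<open>H\<close>, each form of \<open>C\<close> is a nonzero constant or a
  nonzero multiple of a form of \<open>D\<close>, and each form of \<open>D\<close> arises this way.
  Constants separate no points, and a negative factor \<open>s\<close> flips a sign uniformly, so
  the sign classes correspond.\<close>

lemma card_signs_transfer:
  fixes H :: "(nat \<Rightarrow> real) set"
  assumes inv: "\<And>y. g y \<in> H" "\<And>y. f (g y) = y"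
    and CD: "\<And>e. e \<in> C \<Longrightarrow> (\<exists>r. r \<noteq> 0 \<and> (\<forall>x\<in>H. form_val e x = r)) \<or>
        (\<exists>e'\<in>D. \<exists>s. s \<noteq> 0 \<and> (\<forall>x\<in>H. form_val e x = s * form_val e' (f x)))"
    and DC: "\<And>e'. e' \<in> D \<Longrightarrow>
        \<exists>e\<in>C. \<exists>s. s \<noteq> 0 \<and> (\<forall>x\<in>H. form_val e' (f x) = s * form_val e x)"
  shows "card (signs C ` {x \<in> generic C. x \<in> H}) = num_cells D"
  unfolding num_cells_def
proof (rule card_image_eq_transfer[where f = f])
  have gen: "x \<in> generic C \<longleftrightarrow> f x \<in> generic D" if x: "x \<in> H" for x
  proof
    assume "x \<in> generic C"
    then show "f x \<in> generic D" unfolding generic_def using DC x by simp (metis mult_eq_0_iff)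
  next
    assume "f x \<in> generic D"
    then show "x \<in> generic C" unfolding generic_def using CD x by simp (metis mult_eq_0_iff)
  qed
  show "f x \<in> generic D" if "x \<in> {x \<in> generic C. x \<in> H}" for x
    using that gen by blast
  show "\<exists>x\<in>{x \<in> generic C. x \<in> H}. signs D (f x) = signs D y" if "y \<in> generic D" for y
    using that inv gen[of "g y"] by (intro bexI[of _ "g y"]) auto
  show "signs C x = signs C x' \<longleftrightarrow> signs D (f x) = signs D (f x')"
    if "x \<in> {x \<in> generic C. x \<in> H}" "x' \<in> {x \<in> generic C. x \<in> H}" for x x'
  proof -
    have H: "x \<in> H" "x' \<in> H" using that by auto
    show ?thesis unfolding signs_eq_iff
    proof (intro iffI ballI)
      fix e' assume *: "\<forall>e\<in>C. sgn (form_val e x) = sgn (form_val e x')" and "e' \<in> D"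
      then show "sgn (form_val e' (f x)) = sgn (form_val e' (f x'))"
        using DC[of e'] H by (metis sgn_mult)
    next
      fix e assume *: "\<forall>e'\<in>D. sgn (form_val e' (f x)) = sgn (form_val e' (f x'))" and "e \<in> C"
      then show "sgn (form_val e x) = sgn (form_val e x')"
        using CD[of e] H by (metis sgn_mult)
    qed
  qed
qed

section \<open>Regions are sign classes\<close>

text \<open>A form is continuous and never zero on a connected subset of the complement, so its sign
  is constant there. Conversely, the segment between two points with equal signs stays in the
  complement.\<close>

lemma connected_component_iff_signs:
  assumes S: "S = Rn n \<inter> generic C" and x: "x \<in> S" and y: "y \<in> S"
  shows "connected_component S x y \<longleftrightarrow> signs C x = signs C y"
proof
  assume "connected_component S x y"
  then obtain T where T: "connected T" "T \<subseteq> S" "x \<in> T" "y \<in> T"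
    by (auto simp: connected_component_def)
  show "signs C x = signs C y" unfolding signs_eq_iff
  proof
    fix e assume e: "e \<in> C"
    obtain i j c where ijc: "e = (i, j, c)" by (cases e)
    have coord: "continuous_on T (\<lambda>x. x i)" for i
      by (rule continuous_on_product_then_coordinatewise[OF continuous_on_id])
    have "continuous_on T (\<lambda>x. x i - x j - c)"
      by (intro continuous_intros coord)
    then have con: "connected (form_val e ` T)"
      using connected_continuous_image[OF _ T(1)] by (simp add: ijc form_val_def)
    have "0 \<notin> form_val e ` T" using T(2) e by (auto simp: S generic_def)
    then have "\<not> (form_val e x < 0 \<and> 0 < form_val e y)" "\<not> (form_val e y < 0 \<and> 0 < form_val e x)"
      using con T(3,4) unfolding connected_iff_interval by (meson image_eqI less_imp_le)+
    moreover have "form_val e x \<noteq> 0" "form_val e y \<noteq> 0" using x y e by (auto simp: S generic_def)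
    ultimately show "sgn (form_val e x) = sgn (form_val e y)" by (auto simp: sgn_if)
  qed
next
  assume eq: "signs C x = signs C y"
  let ?p = "\<lambda>t::real. \<lambda>i. (1 - t) * x i + t * y i"
  have "continuous_on {0..1} ?p"
    by (intro continuous_on_coordinatewise_then_product continuous_intros)
  then have "connected (?p ` {0..1})" by (intro connected_continuous_image) auto
  moreover have "?p ` {0..1} \<subseteq> S"
  proof
    fix z assume "z \<in> ?p ` {0..1}"
    then obtain t where t: "0 \<le> t" "t \<le> 1" "z = ?p t" by auto
    have "signs C z = signs C x" unfolding t(3)
      by (rule signs_lincomb) (use eq x t S in auto)
    then have "z \<in> generic C" using generic_cong_signs x S by blast
    moreover have "z \<in> Rn n" using x y by (auto simp: t(3) S Rn_def)
    ultimately show "z \<in> S" by (simp add: S)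
  qed
  moreover have "x \<in> ?p ` {0..1}" by (rule image_eqI[of _ _ 0]) auto
  moreover have "y \<in> ?p ` {0..1}" by (rule image_eqI[of _ _ 1]) auto
  ultimately show "connected_component S x y" unfolding connected_component_def by blast
qed

lemma card_regions:
  assumes C: "\<And>i j c. (i, j, c) \<in> C \<Longrightarrow> i \<in> {1..n} \<and> j \<in> {1..n}"
  shows "card (regions n ((\<lambda>(i, j, c). hyp n i j c) ` C)) = num_cells C"
proof -
  let ?A = "(\<lambda>(i, j, c). hyp n i j c) ` C"
  define S where "S = Rn n \<inter> generic C"
  have S: "Rn n - \<Union> ?A = S" by (force simp: S_def hyp_def generic_def form_val_simp)
  have "regions n ?A = connected_component_set S ` S"
    unfolding regions_def S by auto
  also have "card \<dots> = card (signs C ` generic C)"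
  proof (rule card_image_eq_transfer[where f = "\<lambda>x. x"])
    show "x \<in> generic C" if "x \<in> S" for x using that by (simp add: S_def)
    show "\<exists>x\<in>S. signs C x = signs C y" if y: "y \<in> generic C" for y
    proof -
      \<comment> \<open>Truncation moves \<open>y\<close> into \<open>Rn n\<close> without changing
        any form, since \<open>C\<close> mentions only indices in \<open>{1..n}\<close>.\<close>
      let ?x = "\<lambda>i. if i \<in> {1..n} then y i else 0"
      have sg: "signs C ?x = signs C y" using C by (fastforce simp: signs_eq_iff form_val_simp)
      then have "?x \<in> generic C" using generic_cong_signs y by blast
      moreover have "?x \<in> Rn n" by (simp add: Rn_def)
      ultimately show ?thesis using sg by (metis IntI S_def)
    qed
    show "connected_component_set S x = connected_component_set S x' \<longleftrightarrow> signs C x = signs C x'"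
      if "x \<in> S" "x' \<in> S" for x x'
      using connected_component_iff_signs[OF S_def that] that
      by (simp add: connected_component_eq_eq)
  qed
  finally show ?thesis by (simp add: num_cells_def)
qed

section \<open>The interpolating arrangements\<close>

definition arr_forms :: "nat \<Rightarrow> nat \<Rightarrow> nat \<Rightarrow> form set" where
  "arr_forms n m k =
     {(1, j, real c) | j c. 2 \<le> j \<and> j < k \<and> c \<le> m}
   \<union> {(1, j, real c) | j c. k \<le> j \<and> j \<le> n \<and> c \<le> m + 1}
   \<union> {(i, j, c) | i j c. 2 \<le> i \<and> i < j \<and> j \<le> n \<and> (c = 0 \<or> c = 1)}"

text \<open>The Shi arrangement in coordinates 2 to \<open>n\<close>, together with the first
  \<open>k - 2\<close> of the hyperplanes comparing coordinate 1 with the others.\<close>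

definition shi_tail_forms :: "nat \<Rightarrow> nat \<Rightarrow> form set" where
  "shi_tail_forms n k =
     {(1, j, 0) | j. 2 \<le> j \<and> j < k}
   \<union> {(i, j, c) | i j c. 2 \<le> i \<and> i < j \<and> j \<le> n \<and> (c = 0 \<or> c = 1)}"

text \<open>All constants are casts of naturals, so membership reduces to natural-number
  arithmetic.\<close>

lemma arr_forms_iff:
  "(i, j, real c) \<in> arr_forms n m k \<longleftrightarrow>
     i = 1 \<and> 2 \<le> j \<and> j < k \<and> c \<le> m \<or> i = 1 \<and> k \<le> j \<and> j \<le> n \<and> c \<le> m + 1 \<or>
     2 \<le> i \<and> i < j \<and> j \<le> n \<and> c \<le> 1"
  unfolding arr_forms_def by auto

lemma shi_tail_forms_iff:
  "(i, j, real c) \<in> shi_tail_forms n k \<longleftrightarrow>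
     i = 1 \<and> 2 \<le> j \<and> j < k \<and> c = 0 \<or> 2 \<le> i \<and> i < j \<and> j \<le> n \<and> c \<le> 1"
  unfolding shi_tail_forms_def by auto

lemma arr_forms_natE:
  assumes "e \<in> arr_forms n m k"
  obtains i j c where "e = (i, j, real c)"
proof -
  have "\<exists>i j c. e = (i, j, real c)" using assms unfolding arr_forms_def by auto
  then show ?thesis using that by blast
qed

lemma shi_tail_forms_natE:
  assumes "e \<in> shi_tail_forms n k"
  obtains i j c where "e = (i, j, real c)"
proof -
  have "\<exists>i j c. e = (i, j, real c)" using assms unfolding shi_tail_forms_def by auto
  then show ?thesis using that by blast
qed

lemma finite_arr_forms: "finite (arr_forms n m k)"
proof (rule finite_subset)
  show "arr_forms n m k \<subseteq> {..n + k + 1} \<times> {..n + k} \<times> (real ` {..m + 1})"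
  proof
    fix e assume e: "e \<in> arr_forms n m k"
    then obtain i j c where "e = (i, j, real c)" by (rule arr_forms_natE)
    then show "e \<in> {..n + k + 1} \<times> {..n + k} \<times> (real ` {..m + 1})"
      using e by (auto simp: arr_forms_iff)
  qed
qed auto

lemma finite_shi_tail_forms: "finite (shi_tail_forms n k)"
proof (rule finite_subset)
  show "shi_tail_forms n k \<subseteq> {..n + k + 1} \<times> {..n + k} \<times> {0, 1}"
    by (auto simp: shi_tail_forms_def)
qed auto

text \<open>The two sides differ only at \<open>j = k\<close>, where the largest constant is
  \<open>m + 1\<close> on the left and \<open>m\<close> in the deleted arrangement.\<close>

lemma arr_forms_delete:
  assumes "2 \<le> k" "k \<le> n"
  shows "arr_forms n m k = insert (1, k, real (m + 1)) (arr_forms n m (k + 1))"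
proof (intro equalityI subsetI)
  fix e assume e: "e \<in> arr_forms n m k"
  then obtain i j c where "e = (i, j, real c)" by (rule arr_forms_natE)
  then show "e \<in> insert (1, k, real (m + 1)) (arr_forms n m (k + 1))"
    using e assms by (auto simp: arr_forms_iff simp del: of_nat_add of_nat_Suc)
next
  fix e assume "e \<in> insert (1, k, real (m + 1)) (arr_forms n m (k + 1))"
  moreover from this obtain i j c where "e = (i, j, real c)"
    by (metis arr_forms_natE insert_iff)
  ultimately show "e \<in> arr_forms n m k"
    using assms by (auto simp: arr_forms_iff simp del: of_nat_add of_nat_Suc)
qed

lemma arr_forms_restrict:
  assumes k: "2 \<le> k" "k \<le> n"
  shows "card (signs (arr_forms n m (k + 1)) `
            {x \<in> generic (arr_forms n m (k + 1)). x 1 - x k = real (m + 1)})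
       = num_cells (arr_forms (n - 1) (m + 1) k)"
proof -
  let ?C = "arr_forms n m (k + 1)" and ?D = "arr_forms (n - 1) (m + 1) k"
  let ?H = "{x :: nat \<Rightarrow> real. x 1 - x k = real (m + 1)}"
  \<comment> \<open>\<open>?f\<close> drops coordinate \<open>k\<close> and closes the gap;
    \<open>?g\<close> reinserts it with the value that the hyperplane forces.\<close>
  let ?f = "\<lambda>x :: nat \<Rightarrow> real. \<lambda>i. if i < k then x i else x (i + 1)"
  let ?g = "\<lambda>y :: nat \<Rightarrow> real. \<lambda>i. if i < k then y i else if i = k then y 1 - real (m + 1) else y (i - 1)"
  have "card (signs ?C ` {x \<in> generic ?C. x \<in> ?H}) = num_cells ?D"
  proof (rule card_signs_transfer[where g = ?g and f = ?f])
    show "?g y \<in> ?H" for y using k by simp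
    show "?f (?g y) = y" for y by auto
  next
    fix e assume e: "e \<in> ?C"
    then obtain i j c where ijc: "e = (i, j, real c)" by (rule arr_forms_natE)
    let ?i = "if i \<le> k then i else i - 1" and ?j = "if j \<le> k then j else j - 1"
    have off: "(?i, ?j, real c) \<in> ?D" if "i \<noteq> k" "j \<noteq> k"
      using e k that unfolding ijc arr_forms_iff by (cases "i < k"; cases "j < k") auto
    \<comment> \<open>Forms between 1 and \<open>k\<close> become nonzero constants
      (\<open>eq\<close>), and forms avoiding \<open>k\<close> are only re-indexed
      (\<open>ne\<close>). A Shi form with \<open>k\<close> as second index becomes minus a form in
      coordinate 1 (\<open>shi1\<close>); with \<open>k\<close> as first index it becomes such a
      form directly (\<open>shi2\<close>).\<close>
    consider
        (eq) "i = 1" "j = k" "c \<le> m"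
      | (ne) "i \<noteq> k" "j \<noteq> k"
      | (shi1) "2 \<le> i" "i < k" "j = k" "c \<le> 1"
      | (shi2) "i = k" "k < j" "j \<le> n" "c \<le> 1"
      using e k unfolding ijc arr_forms_iff by (cases "i = k"; cases "j = k") auto
    then show "(\<exists>r. r \<noteq> 0 \<and> (\<forall>x\<in>?H. form_val e x = r)) \<or>
        (\<exists>e'\<in>?D. \<exists>s. s \<noteq> 0 \<and> (\<forall>x\<in>?H. form_val e x = s * form_val e' (?f x)))"
    proof cases
      case eq
      then show ?thesis
        by (intro disjI1 exI[of _ "real (m + 1) - real c"]) (auto simp: ijc form_val_simp)
    next
      case ne
      then show ?thesis
        by (intro disjI2 bexI[OF _ off[OF ne]] exI[of _ 1]) (auto simp: ijc form_val_simp)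
    next
      case shi1
      then have "(1, i, real (m + 1 - c)) \<in> ?D" unfolding arr_forms_iff by auto
      then show ?thesis
        by (intro disjI2 bexI[of _ "(1, i, real (m + 1 - c))"] exI[of _ "-1"])
          (use shi1 k in \<open>auto simp: ijc form_val_simp of_nat_diff\<close>)
    next
      case shi2
      then have "(1, j - 1, real (m + 1 + c)) \<in> ?D" using k unfolding arr_forms_iff by auto
      then show ?thesis
        by (intro disjI2 bexI[of _ "(1, j - 1, real (m + 1 + c))"] exI[of _ 1])
          (use shi2 k in \<open>auto simp: ijc form_val_simp\<close>)
    qed
  next
    fix e' assume e': "e' \<in> ?D"
    then obtain i j c where ijc: "e' = (i, j, real c)" by (rule arr_forms_natE)
    let ?i = "if i < k then i else i + 1" and ?j = "if j < k then j else j + 1"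
    have n1: "j \<le> n - 1 \<longleftrightarrow> j + 1 \<le> n" using k by auto
    \<comment> \<open>Only the largest constant at coordinate 1 is new: it comes from the Shi form
      with constant 0 for indices below \<open>k\<close> (\<open>lt\<close>), and from the one with
      constant 1 for the others (\<open>ge\<close>).\<close>
    consider
        (keep) "i = 1 \<longrightarrow> c \<le> (if j < k then m else m + 1)"
      | (lt) "i = 1" "2 \<le> j" "j < k" "c = m + 1"
      | (ge) "i = 1" "k \<le> j" "j + 1 \<le> n" "c = m + 2"
      using e' k le_Suc_eq[of c m] le_Suc_eq[of c "Suc m"] unfolding ijc arr_forms_iff n1
      by (cases "i = 1"; cases "j < k") auto
    then show "\<exists>e\<in>?C. \<exists>s. s \<noteq> 0 \<and> (\<forall>x\<in>?H. form_val e' (?f x) = s * form_val e x)"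
    proof cases
      case keep
      then have *: "(?i, ?j, real c) \<in> ?C"
        using e' k unfolding ijc arr_forms_iff by (cases "i < k"; cases "j < k") auto
      show ?thesis
        by (intro bexI[OF _ *] exI[of _ 1]) (auto simp: ijc form_val_simp)
    next
      case lt
      then have "(j, k, real 0) \<in> ?C" using k unfolding arr_forms_iff by auto
      then show ?thesis
        by (intro bexI[of _ "(j, k, real 0)"] exI[of _ "-1"])
          (use lt k in \<open>auto simp: ijc form_val_simp\<close>)
    next
      case ge
      then have "(k, j + 1, real 1) \<in> ?C" using k unfolding arr_forms_iff by auto
      then show ?thesis
        by (intro bexI[of _ "(k, j + 1, real 1)"] exI[of _ 1])
          (use ge k in \<open>auto simp: ijc form_val_simp\<close>)
    qed
  qed
  then show ?thesis by simp
qed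

lemma arr_forms_rec:
  assumes k: "2 \<le> k" "k \<le> n"
  shows "num_cells (arr_forms n m k)
       = num_cells (arr_forms n m (k + 1)) + num_cells (arr_forms (n - 1) (m + 1) k)"
  unfolding arr_forms_delete[OF k] arr_forms_restrict[OF k, symmetric]
  by (rule num_cells_insert) (use k finite_arr_forms in auto)

text \<open>At \<open>k = n + 1\<close> the second family is empty and at \<open>k = 2\<close> the
  first, so on both sides every \<open>j\<close> carries the constants 0 to \<open>m + 1\<close>.
  This is what drives the induction on \<open>m\<close>.\<close>

lemma arr_forms_wrap: "arr_forms n (m + 1) (n + 1) = arr_forms n m 2"
  unfolding arr_forms_def by auto

lemma arr_forms_shi_tail: "arr_forms n 0 (n + 1) = shi_tail_forms n (n + 1)"
  unfolding arr_forms_def shi_tail_forms_def by auto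

section \<open>A coordinate compared only by order\<close>

text \<open>For \<open>k = 2\<close> no form mentions coordinate 1, so it can be discarded and the
  others shifted down.\<close>

lemma shi_tail_forms_shift:
  "num_cells (shi_tail_forms n 2) = num_cells (arr_forms (n - 1) 0 2)"
proof -
  let ?C = "shi_tail_forms n 2" and ?D = "arr_forms (n - 1) 0 2"
  let ?f = "\<lambda>x :: nat \<Rightarrow> real. \<lambda>i. if i = 0 then x 0 else x (i + 1)"
  \<comment> \<open>Coordinate 1 receives the arbitrary value \<open>y 0\<close>; index 0 is carried
    along so that \<open>?f\<close> undoes \<open>?g\<close> on entire functions.\<close>
  let ?g = "\<lambda>y :: nat \<Rightarrow> real. \<lambda>i. if i = 0 then y 0 else y (i - 1)"
  have "card (signs ?C ` {x \<in> generic ?C. x \<in> UNIV}) = num_cells ?D"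
  proof (rule card_signs_transfer[where g = ?g and f = ?f])
    show "?f (?g y) = y" for y by auto
  next
    fix e assume e: "e \<in> ?C"
    then obtain i j c where ijc: "e = (i, j, real c)" by (rule shi_tail_forms_natE)
    have *: "(i - 1, j - 1, real c) \<in> ?D" and "2 \<le> i" "2 \<le> j"
      using e unfolding ijc arr_forms_iff shi_tail_forms_iff by auto
    then show "(\<exists>r. r \<noteq> 0 \<and> (\<forall>x\<in>UNIV. form_val e x = r)) \<or>
        (\<exists>e'\<in>?D. \<exists>s. s \<noteq> 0 \<and> (\<forall>x\<in>UNIV. form_val e x = s * form_val e' (?f x)))"
      by (intro disjI2 bexI[OF _ *] exI[of _ 1]) (auto simp: ijc form_val_simp)
  next
    fix e' assume e': "e' \<in> ?D"
    then obtain i j c where ijc: "e' = (i, j, real c)" by (rule arr_forms_natE)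
    have *: "(i + 1, j + 1, real c) \<in> ?C" and "1 \<le> i" "1 \<le> j"
      using e' unfolding ijc arr_forms_iff shi_tail_forms_iff by auto
    then show "\<exists>e\<in>?C. \<exists>s. s \<noteq> 0 \<and> (\<forall>x\<in>UNIV. form_val e' (?f x) = s * form_val e x)"
      by (intro bexI[OF _ *] exI[of _ 1]) (auto simp: ijc form_val_simp)
  qed auto
  then show ?thesis by (simp add: num_cells_def)
qed

text \<open>On \<open>x 1 = x k\<close>, the comparison of coordinate 1 with \<open>j < k\<close>
  is, up to sign, the Shi form \<open>(j, k, 0)\<close> already present. Only the Shi arrangement on
  the remaining \<open>n - 1\<close> coordinates is left, whatever \<open>k\<close> is.\<close>

lemma shi_tail_forms_restrict:
  assumes k: "2 \<le> k" "k \<le> n"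
  shows "card (signs (shi_tail_forms n k) ` {x \<in> generic (shi_tail_forms n k). x 1 - x k = 0})
       = num_cells (arr_forms (n - 1) 0 2)"
proof -
  let ?C = "shi_tail_forms n k" and ?D = "arr_forms (n - 1) 0 2"
  let ?H = "{x :: nat \<Rightarrow> real. x 1 - x k = 0}"
  let ?f = "\<lambda>x :: nat \<Rightarrow> real. \<lambda>i. if i = 0 then x 0 else x (i + 1)"
  let ?g = "\<lambda>y :: nat \<Rightarrow> real. \<lambda>i. if i = 0 then y 0 else if i = 1 then y (k - 1) else y (i - 1)"
  have "card (signs ?C ` {x \<in> generic ?C. x \<in> ?H}) = num_cells ?D"
  proof (rule card_signs_transfer[where g = ?g and f = ?f])
    show "?g y \<in> ?H" for y using k by simp
    show "?f (?g y) = y" for y by auto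
  next
    fix e assume e: "e \<in> ?C"
    then obtain i j c where ijc: "e = (i, j, real c)" by (rule shi_tail_forms_natE)
    consider
        (one) "i = 1" "2 \<le> j" "j < k" "c = 0"
      | (shi) "2 \<le> i" "2 \<le> j" "(i - 1, j - 1, real c) \<in> ?D"
      using e unfolding ijc arr_forms_iff shi_tail_forms_iff by force
    then show "(\<exists>r. r \<noteq> 0 \<and> (\<forall>x\<in>?H. form_val e x = r)) \<or>
        (\<exists>e'\<in>?D. \<exists>s. s \<noteq> 0 \<and> (\<forall>x\<in>?H. form_val e x = s * form_val e' (?f x)))"
    proof cases
      case one
      then have "(j - 1, k - 1, real 0) \<in> ?D" using k unfolding arr_forms_iff by auto
      then show ?thesis
        by (intro disjI2 bexI[of _ "(j - 1, k - 1, real 0)"] exI[of _ "-1"])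
          (use one k in \<open>auto simp: ijc form_val_simp\<close>)
    next
      case shi
      then show ?thesis
        by (intro disjI2 bexI[OF _ shi(3)] exI[of _ 1]) (auto simp: ijc form_val_simp)
    qed
  next
    fix e' assume e': "e' \<in> ?D"
    then obtain i j c where ijc: "e' = (i, j, real c)" by (rule arr_forms_natE)
    have *: "(i + 1, j + 1, real c) \<in> ?C" and "1 \<le> i" "1 \<le> j"
      using e' unfolding ijc arr_forms_iff shi_tail_forms_iff by auto
    then show "\<exists>e\<in>?C. \<exists>s. s \<noteq> 0 \<and> (\<forall>x\<in>?H. form_val e' (?f x) = s * form_val e x)"
      by (intro bexI[OF _ *] exI[of _ 1]) (auto simp: ijc form_val_simp)
  qed
  then show ?thesis by simp
qed

text \<open>Each of the \<open>k - 2\<close> comparisons adds the same number of cells as there are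
  without any, giving the factor \<open>1 + (k - 2)\<close>.\<close>

lemma num_cells_shi_tail:
  assumes "2 \<le> k" "k \<le> n + 1"
  shows "num_cells (shi_tail_forms n k) = (k - 1) * num_cells (arr_forms (n - 1) 0 2)"
  using assms
proof (induction k rule: dec_induct)
  case base
  then show ?case using shi_tail_forms_shift by simp
next
  case (step k)
  have "shi_tail_forms n (Suc k) = insert (1, k, 0) (shi_tail_forms n k)"
    using step.hyps by (auto simp: shi_tail_forms_def less_Suc_eq)
  then have "num_cells (shi_tail_forms n (Suc k))
      = num_cells (shi_tail_forms n k) + num_cells (arr_forms (n - 1) 0 2)"
    using num_cells_insert[OF finite_shi_tail_forms, of 1 k 0 n k] shi_tail_forms_restrict[of k n] step
    by simp
  also have "\<dots> = k * num_cells (arr_forms (n - 1) 0 2)"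
    using step by (cases k) auto
  finally show ?case by simp
qed

section \<open>Counting\<close>

text \<open>Three nested inductions: on \<open>n\<close>, then on \<open>m\<close> for the value at
  \<open>k = n + 1\<close>, and from there downwards in \<open>k\<close>.\<close>

lemma num_cells_arr_forms:
  assumes "1 \<le> n" "2 \<le> k" "k \<le> n + 1"
  shows "num_cells (arr_forms n m k) = (n + m) ^ (k - 2) * (n + m + 1) ^ (n + 1 - k)"
  using assms
proof (induction n arbitrary: m k rule: dec_induct)
  case base
  then have "arr_forms 1 m k = {}" by (auto simp: arr_forms_def)
  moreover have "signs {} ` generic {} = {\<lambda>e. 0}" by (auto simp: signs_def generic_def)
  ultimately show ?case using base by (simp add: num_cells_def)
next
  case (step n)
  let ?n = "Suc n"
  \<comment> \<open>For fixed \<open>m\<close>, the value at the top index determines all smaller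
    \<open>k\<close> through the recurrence, whose restricted term is known from dimension
    \<open>n\<close>.\<close>
  have down: "num_cells (arr_forms ?n m k) = (?n + m) ^ (k - 2) * (?n + m + 1) ^ (?n + 1 - k)"
    if top: "num_cells (arr_forms ?n m (?n + 1)) = (?n + m) ^ (?n - 1)"
      and "2 \<le> k" "k \<le> ?n + 1" for m k
    using that(3,2)
  proof (induction k rule: inc_induct)
    case base
    then show ?case using top by simp
  next
    case (step k)
    then have k: "2 \<le> k" "k \<le> ?n" by auto
    \<comment> \<open>The variables \<open>d\<close> and \<open>l\<close> replace truncated
      subtractions in the exponents.\<close>
    obtain d where d: "?n = k + d" using k(2) le_Suc_ex by blast
    obtain l where l: "k = l + 2" using k(1) by (metis add.commute le_Suc_ex)
    have "num_cells (arr_forms ?n m k)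
        = num_cells (arr_forms ?n m (Suc k)) + num_cells (arr_forms n (m + 1) k)"
      using arr_forms_rec[OF k] by simp
    also have "num_cells (arr_forms ?n m (Suc k)) = (?n + m) ^ Suc l * (?n + m + 1) ^ d"
      using step d l by simp
    \<comment> \<open>Restriction lowers the dimension and raises \<open>m\<close>, keeping their
      sum, so both terms have powers of the same two bases.\<close>
    also have "num_cells (arr_forms n (m + 1) k) = (?n + m) ^ l * (?n + m + 1) ^ d"
      using \<open>\<And>m k. 2 \<le> k \<Longrightarrow> k \<le> n + 1 \<Longrightarrow> num_cells (arr_forms n m k) = _\<close>[of k "m + 1"] k d l
      by simp
    also have "(?n + m) ^ Suc l * (?n + m + 1) ^ d + (?n + m) ^ l * (?n + m + 1) ^ d
        = (?n + m) ^ l * (?n + m + 1) ^ Suc d"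
      by (simp add: algebra_simps)
    also have "\<dots> = (?n + m) ^ (k - 2) * (?n + m + 1) ^ (?n + 1 - k)"
      using d l by simp
    finally show ?case .
  qed
  \<comment> \<open>For \<open>m = 0\<close> the value comes from the order-only count; the top
    value for \<open>m + 1\<close> is the value for \<open>m\<close> at \<open>k = 2\<close>,
    supplied by \<open>down\<close>.\<close>
  have "num_cells (arr_forms ?n m (?n + 1)) = (?n + m) ^ (?n - 1)" for m
  proof (induction m)
    case 0
    have "num_cells (arr_forms ?n 0 (?n + 1)) = ?n * num_cells (arr_forms n 0 2)"
      using num_cells_shi_tail[of "?n + 1" ?n] step.hyps unfolding arr_forms_shi_tail by simp
    also have "num_cells (arr_forms n 0 2) = ?n ^ (n - 1)"
      using step.IH[of 2 0] step.hyps by simp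
    also have "?n * ?n ^ (n - 1) = ?n ^ n" using step.hyps by (cases n) auto
    finally show ?case by simp
  next
    case (Suc m)
    have "num_cells (arr_forms ?n (m + 1) (?n + 1)) = num_cells (arr_forms ?n m 2)"
      by (simp only: arr_forms_wrap)
    also have "\<dots> = (?n + m + 1) ^ n"
      using down[OF Suc, of 2] by simp
    finally show ?case by simp
  qed
  then show ?case using down step.prems by blast
qed

lemma arr_conv_forms: "arr n m k = (\<lambda>(i, j, c). hyp n i j c) ` arr_forms n m k"
  unfolding arr_def arr_forms_def image_Un
  by (intro arg_cong2[where f = "(\<union>)"]) (auto simp: image_iff)

lemma card_regions_arr:
  assumes "1 \<le> n" "2 \<le> k" "k \<le> n + 1"
  shows "card (regions n (arr n m k)) = (n + m) ^ (k - 2) * (n + m + 1) ^ (n + 1 - k)"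
proof -
  have "i \<in> {1..n} \<and> j \<in> {1..n}" if "(i, j, c) \<in> arr_forms n m k" for i j c
    using that assms by (auto simp: arr_forms_def)
  then show ?thesis
    using card_regions[of "arr_forms n m k" n] num_cells_arr_forms[OF assms]
    by (simp add: arr_conv_forms)
qed

text \<open>With \<open>m = 0\<close> and \<open>k = 2\<close> coordinate 1 is compared with every
  other one at constants 0 and 1, just like the remaining pairs.\<close>

lemma shi_eq_arr: "shi n = arr n 0 2"
proof (intro equalityI subsetI)
  fix h assume "h \<in> shi n"
  then obtain i j c where h: "h = hyp n i j (real c)" "1 \<le> i" "i < j" "j \<le> n" "c \<le> 1"
  proof -
    obtain i j c where "h = hyp n i j c" "1 \<le> i" "i < j" "j \<le> n" "c = 0 \<or> c = 1"
      using \<open>h \<in> shi n\<close> unfolding shi_def by blast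
    then show thesis using that[of i j 0] that[of i j 1] by auto
  qed
  then have "(i, j, real c) \<in> arr_forms n 0 2" unfolding arr_forms_iff by auto
  then show "h \<in> arr n 0 2" unfolding arr_conv_forms h(1) by force
next
  fix h assume "h \<in> arr n 0 2"
  then obtain e where e: "e \<in> arr_forms n 0 2" "h = (\<lambda>(i, j, c). hyp n i j c) e"
    unfolding arr_conv_forms by blast
  then obtain i j c where ijc: "e = (i, j, real c)" using arr_forms_natE by blast
  then have "1 \<le> i \<and> i < j \<and> j \<le> n \<and> (real c = 0 \<or> real c = 1)"
    using e(1) by (auto simp: arr_forms_iff)
  then show "h \<in> shi n" unfolding shi_def e(2) ijc by fast
qed

theorem theorem4p1:
  fixes n m k :: nat
  assumes "1 \<le> n" and "2 \<le> k" and "k \<le> n + 1"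
  shows "card (regions n (arr n m k)) = (n + m) ^ (k - 2) * (n + m + 1) ^ (n + 1 - k)
         \<and> card (regions n (shi n)) = (n + 1) ^ (n - 1)"
  using card_regions_arr[OF assms, of m] card_regions_arr[of n 2 0] assms(1)
  by (simp add: shi_eq_arr)

end
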